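(* There is an absolute constant $C>0$ such that for every positive integer $n$ there exists an array $p=(p_{ijk})\in(\mathbb{R}_{\geq 0}^n)^{\otimes 3}$ with $O(n)$ nonzero entries, each of bit-complexity $O(n)$, with the following property: for all $0<\varepsilon\leq \exp(-Cn^2\log n)$ and all $(x,y,z)\in\mathbb{R}^{3n}$, if $$f_p(x,y,z)\leq \operatorname{cap}(p)+\varepsilon,$$ then $\|(x,y,z)\|_2=\Omega\left(2^{n/3}\log(1/\varepsilon)\right)$ (the implied constant being absolute).
   Context: For $i\in[n]$ let $e_i\in\mathbb{R}^n$ be the $i$-th standard unit vector, $\mathbb{1}_n$ the all-ones vector, and $\varepsilon_i:=e_i-\frac1n\mathbb{1}_n$. For an array $p\in(\mathbb{R}_{\geq0}^n)^{\otimes 3}$ define $f_p:\mathbb{R}^{3n}\to\mathbb{R}$ by $f_p(x,y,z)=\sum_{i,j,k\in[n]}p_{ijk}\exp(\varepsilon_i\cdot x+\varepsilon_j\cdot y+\varepsilon_k\cdot z)$, and the capacity $\operatorname{cap}(p):=\inf_{(x,y,z)\in\mathbb{R}^{3n}}f_p(x,y,z)$.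
   Formalization: The norm lower bound is asserted only for n ≥ 2: for n = 1 the function f_p is constant, so (0,0,0) satisfies the hypothesis with norm 0 and the bound fails for every array p when ε < 1. *)

theory Defs
  imports Complex_Main "HOL-Library.Log_Nat"
begin

text \<open>
  The dimension is a variable of the statement, so a vector of length \<open>n\<close> is a function
  \<open>nat \<Rightarrow> real\<close> and an array is a function of three indices. Every notion below takes \<open>n\<close>
  explicitly and depends only on the values at indices in \<open>{1..n}\<close>; in particular the infimum
  over all functions in \<open>cap\<close> is the infimum over all real \<open>3n\<close>-tuples.
\<close>

definition unit_vector :: "nat \<Rightarrow> nat \<Rightarrow> real" where
  "unit_vector i = (\<lambda>l. if l = i then 1 else 0)"

definition eps_vector :: "nat \<Rightarrow> nat \<Rightarrow> nat \<Rightarrow> real" where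
  "eps_vector n i = (\<lambda>l. unit_vector i l - 1 / real n)"

definition dot :: "nat \<Rightarrow> (nat \<Rightarrow> real) \<Rightarrow> (nat \<Rightarrow> real) \<Rightarrow> real" where
  "dot n u v = (\<Sum>l\<in>{1..n}. u l * v l)"

definition norm3 :: "nat \<Rightarrow> (nat \<Rightarrow> real) \<Rightarrow> (nat \<Rightarrow> real) \<Rightarrow> (nat \<Rightarrow> real) \<Rightarrow> real" where
  "norm3 n x y z = sqrt (dot n x x + dot n y y + dot n z z)"

definition nonneg_array :: "nat \<Rightarrow> (nat \<Rightarrow> nat \<Rightarrow> nat \<Rightarrow> real) \<Rightarrow> bool" where
  "nonneg_array n p \<longleftrightarrow> (\<forall>i\<in>{1..n}. \<forall>j\<in>{1..n}. \<forall>k\<in>{1..n}. p i j k \<ge> 0)"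

definition array_support :: "nat \<Rightarrow> (nat \<Rightarrow> nat \<Rightarrow> nat \<Rightarrow> real) \<Rightarrow> (nat \<times> nat \<times> nat) set" where
  "array_support n p = {(i, j, k). i \<in> {1..n} \<and> j \<in> {1..n} \<and> k \<in> {1..n} \<and> p i j k \<noteq> 0}"

definition f_fun :: "nat \<Rightarrow> (nat \<Rightarrow> nat \<Rightarrow> nat \<Rightarrow> real) \<Rightarrow>
    (nat \<Rightarrow> real) \<Rightarrow> (nat \<Rightarrow> real) \<Rightarrow> (nat \<Rightarrow> real) \<Rightarrow> real" where
  "f_fun n p x y z = (\<Sum>i\<in>{1..n}. \<Sum>j\<in>{1..n}. \<Sum>k\<in>{1..n}.
     p i j k * exp (dot n (eps_vector n i) x + dot n (eps_vector n j) y + dot n (eps_vector n k) z))"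

text \<open>For a nonnegative array the values of \<open>f_fun\<close> are bounded below by \<open>0\<close>, so this real
  infimum is meaningful.\<close>

definition cap :: "nat \<Rightarrow> (nat \<Rightarrow> nat \<Rightarrow> nat \<Rightarrow> real) \<Rightarrow> real" where
  "cap n p = (INF (x, y, z)\<in>UNIV. f_fun n p x y z)"

text \<open>Total binary length of numerator and denominator in lowest terms.\<close>

definition rat_bit_complexity :: "rat \<Rightarrow> int" where
  "rat_bit_complexity q = bitlen \<bar>fst (quotient_of q)\<bar> + bitlen (snd (quotient_of q))"

end

theory Submission
  imports Defs
begin

text \<open>
  Take weighted triples with uniform marginals, so that the weighted sum of their exponents
  vanishes identically and \<open>exp t \<ge> 1 + t\<close> makes the sum of the weights a lower bound, attained
  exactly when all these exponents are \<open>0\<close>. Add one further triple of weight \<open>1\<close> whose exponent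
  can be sent to \<open>-\<infinity>\<close> while the others stay \<open>0\<close>. The capacity is then the sum of the weights, and
  at an \<open>\<epsilon>\<close>-minimizer the extra exponent is at most \<open>- ln (1 / \<epsilon>)\<close> while the others are bounded.

  The triples \<open>(k + 1, k, k)\<close>, \<open>(k, k + 1, k)\<close>, \<open>(k, k, k + 1)\<close> force
  \<open>s (k + 1) = - 2 * s k + O(1)\<close> for \<open>s k = x k + y k + z k\<close> (with \<open>x\<close>, \<open>y\<close>, \<open>z\<close> centred). Hence if the
  extra exponent is \<open>s\<close> at the start of a chain of length \<open>m\<close>, then \<open>s\<close> at its end is larger by a
  factor of order \<open>2 ^ m\<close>. A single chain does not admit uniform marginals. Two chains carrying
  opposite values, joined at their ends through an index of value \<open>0\<close>, do; this uses \<open>2 * m + 3\<close>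
  indices, so \<open>2 ^ m\<close> is at least of order \<open>2 powr (n / 3)\<close>.
\<close>

section \<open>Arrays given by lists of weighted triples\<close>

definition array_of :: "(int \<times> nat \<times> nat \<times> nat) list \<Rightarrow> nat \<Rightarrow> nat \<Rightarrow> nat \<Rightarrow> real" where
  "array_of rs i j k =
     (\<Sum>(w, a, b, c)\<leftarrow>rs. if a = i \<and> b = j \<and> c = k then real_of_int w else 0)"

definition valid :: "nat \<Rightarrow> (int \<times> nat \<times> nat \<times> nat) list \<Rightarrow> bool" where
  "valid n rs \<longleftrightarrow>
     (\<forall>(w, a, b, c)\<in>set rs. 0 \<le> w \<and> a \<in> {1..n} \<and> b \<in> {1..n} \<and> c \<in> {1..n})"

text \<open>Uniform marginals in dual form: testing on indicator functions says that each slot has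
  marginal \<open>D\<close> at every index of \<open>{1..n}\<close>. The linear form can be applied
  directly to the exponents.\<close>

definition balanced :: "nat \<Rightarrow> int \<Rightarrow> (int \<times> nat \<times> nat \<times> nat) list \<Rightarrow> bool" where
  "balanced n D rs \<longleftrightarrow> (\<forall>X Y Z :: nat \<Rightarrow> real.
     (\<Sum>(w, a, b, c)\<leftarrow>rs. real_of_int w * (X a + Y b + Z c)) =
     real_of_int D * ((\<Sum>i\<in>{1..n}. X i) + (\<Sum>i\<in>{1..n}. Y i) + (\<Sum>i\<in>{1..n}. Z i)))"

lemma valid_Nil [simp]: "valid n []"
  and valid_Cons [simp]: "valid n ((w, a, b, c) # rs) \<longleftrightarrow>
    0 \<le> w \<and> a \<in> {1..n} \<and> b \<in> {1..n} \<and> c \<in> {1..n} \<and> valid n rs"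
  by (auto simp: valid_def)

lemma f_fun_array_of:
  assumes "valid n rs"
  shows "f_fun n (array_of rs) x y z = (\<Sum>(w, a, b, c)\<leftarrow>rs. real_of_int w *
    exp (dot n (eps_vector n a) x + dot n (eps_vector n b) y + dot n (eps_vector n c) z))"
  using assms
proof (induction rs)
  case Nil
  show ?case by (simp add: f_fun_def array_of_def)
next
  case (Cons r rs)
  obtain w a b c where r: "r = (w, a, b, c)" by (cases r)
  define E where "E i j k = exp (dot n (eps_vector n i) x + dot n (eps_vector n j) y
    + dot n (eps_vector n k) z)" for i j k
  have abc: "a \<in> {1..n}" "b \<in> {1..n}" "c \<in> {1..n}" and v: "valid n rs"
    using Cons.prems by (auto simp: r)
  have "f_fun n (array_of (r # rs)) x y z =
      (\<Sum>i\<in>{1..n}. \<Sum>j\<in>{1..n}. \<Sum>k\<in>{1..n}.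
         (if a = i \<and> b = j \<and> c = k then real_of_int w else 0) * E i j k)
      + f_fun n (array_of rs) x y z"
    by (simp add: f_fun_def array_of_def r E_def ring_distribs sum.distrib)
  also have "(\<Sum>i\<in>{1..n}. \<Sum>j\<in>{1..n}. \<Sum>k\<in>{1..n}.
         (if a = i \<and> b = j \<and> c = k then real_of_int w else 0) * E i j k)
     = real_of_int w * E a b c"
  proof -
    have 1: "(\<Sum>k\<in>{1..n}. (if a = i \<and> b = j \<and> c = k then real_of_int w else 0) * E i j k)
        = (if b = j then if a = i then real_of_int w * E i j c else 0 else 0)" for i j
      using abc(3) by (cases "a = i \<and> b = j") (auto simp: if_distrib[of "\<lambda>u. u * _"] cong: if_cong)
    have 2: "(\<Sum>j\<in>{1..n}. if b = j then if a = i then real_of_int w * E i j c else 0 else 0)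
        = (if a = i then real_of_int w * E i b c else 0)" for i
      using abc(2) by simp
    show ?thesis unfolding 1 2 using abc(1) by simp
  qed
  finally show ?case
    using Cons.IH[OF v] by (simp add: r E_def)
qed

lemma nonneg_array_of: "valid n rs \<Longrightarrow> nonneg_array n (array_of rs)"
  unfolding nonneg_array_def array_of_def valid_def
  by (fastforce intro!: sum_list_nonneg)

lemma card_array_support_array_of: "card (array_support n (array_of rs)) \<le> length rs"
proof -
  have "array_support n (array_of rs) \<subseteq> set (map snd rs)"
  proof (clarify)
    fix i j k assume "(i, j, k) \<in> array_support n (array_of rs)"
    then have "array_of rs i j k \<noteq> 0" by (simp add: array_support_def)
    then have "\<exists>r\<in>set rs. (case r of (w, a, b, c) \<Rightarrow>
        if a = i \<and> b = j \<and> c = k then real_of_int w else 0) \<noteq> 0"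
      unfolding array_of_def
      by (metis (no_types, lifting) map_eq_conv sum_list_0)
    then show "(i, j, k) \<in> set (map snd rs)"
      by (force split: prod.splits if_splits)
  qed
  then have "card (array_support n (array_of rs)) \<le> card (set (map snd rs))"
    by (intro card_mono) auto
  also have "\<dots> \<le> length rs"
    using card_length[of "map snd rs"] by simp
  finally show ?thesis .
qed

lemma array_of_int:
  assumes "valid n rs"
  shows "\<exists>q. array_of rs i j k = real_of_int q \<and> 0 \<le> q \<and> q \<le> sum_list (map fst rs)"
  using assms
proof (induction rs)
  case Nil
  show ?case by (simp add: array_of_def)
next
  case (Cons r rs)
  obtain w a b c where r: "r = (w, a, b, c)" by (cases r)
  obtain q where q: "array_of rs i j k = real_of_int q" "0 \<le> q" "q \<le> sum_list (map fst rs)"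
    using Cons.IH Cons.prems unfolding r valid_Cons by blast
  have "0 \<le> w" using Cons.prems by (simp add: r)
  then show ?case
    using q
    by (intro exI[of _ "(if a = i \<and> b = j \<and> c = k then w else 0) + q"])
       (auto simp: array_of_def r)
qed

text \<open>The additional bit is that of the denominator 1.\<close>

lemma rat_bit_complexity_of_int_le:
  assumes "0 \<le> q" "q < 2 ^ N"
  shows "rat_bit_complexity (of_int q) \<le> int N + 1"
proof -
  have "bitlen q \<le> int N"
    using assms by (cases "q = 0") (simp_all add: bitlen_le_iff_power)
  then show ?thesis
    using assms by (simp add: rat_bit_complexity_def bitlen_def floorlog_def)
qed

lemma sum_weights_balanced:
  assumes "balanced n D rs"
  shows "sum_list (map fst rs) = D * int n"
proof -
  \<comment> \<open>The test functions 1, 0, 0 count the weight of every triple once.\<close>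
  have "(\<Sum>(w, a, b, c)\<leftarrow>rs. real_of_int w * ((\<lambda>_. 1) a + (\<lambda>_. 0) b + (\<lambda>_. 0) c)) =
     real_of_int D * ((\<Sum>i\<in>{1..n}. (\<lambda>_. 1) i) + (\<Sum>i\<in>{1..n}. (\<lambda>_. 0) i) + (\<Sum>i\<in>{1..n}. (\<lambda>_. 0) i))"
    using assms unfolding balanced_def by (elim allE)
  then have "(\<Sum>(w, a, b, c)\<leftarrow>rs. real_of_int w) = real_of_int (D * int n)"
    by simp
  moreover have "(\<Sum>(w, a, b, c)\<leftarrow>rs. real_of_int w) = real_of_int (sum_list (map fst rs))"
    by (induction rs) auto
  ultimately show ?thesis by linarith
qed

section \<open>Centred coordinates and the norm\<close>

lemma dot_eps_vector:
  assumes "i \<in> {1..n}"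
  shows "dot n (eps_vector n i) x = x i - (\<Sum>l\<in>{1..n}. x l) / real n"
proof -
  have "dot n (eps_vector n i) x = (\<Sum>l\<in>{1..n}. (if l = i then x l else 0) - x l / real n)"
    unfolding dot_def eps_vector_def unit_vector_def
    by (intro sum.cong) (auto simp: algebra_simps)
  also have "\<dots> = x i - (\<Sum>l\<in>{1..n}. x l) / real n"
    using assms by (simp add: sum_subtractf sum_divide_distrib)
  finally show ?thesis .
qed

lemma sum_dot_eps_vector:
  assumes "n \<ge> 1"
  shows "(\<Sum>i\<in>{1..n}. dot n (eps_vector n i) x) = 0"
proof -
  have "(\<Sum>i\<in>{1..n}. dot n (eps_vector n i) x) =
      (\<Sum>i\<in>{1..n}. x i - (\<Sum>l\<in>{1..n}. x l) / real n)"
    by (intro sum.cong refl dot_eps_vector)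
  then show ?thesis using assms by (simp add: sum_subtractf)
qed

text \<open>A coordinate and the mean of all coordinates are each at most \<open>N\<close> in
  absolute value.\<close>

lemma abs_dot_eps_vector_le:
  assumes "i \<in> {1..n}" and N: "dot n x x \<le> N ^ 2" "0 \<le> N"
  shows "\<bar>dot n (eps_vector n i) x\<bar> \<le> 2 * N"
proof -
  have le: "\<bar>x l\<bar> \<le> N" if "l \<in> {1..n}" for l
  proof -
    have "x l * x l \<le> dot n x x"
      unfolding dot_def by (rule member_le_sum) (use that in auto)
    then have "\<bar>x l\<bar> ^ 2 \<le> N ^ 2" using N by (simp add: power2_eq_square)
    then show ?thesis using N(2) by (rule power2_le_imp_le)
  qed
  have "\<bar>\<Sum>l\<in>{1..n}. x l\<bar> \<le> (\<Sum>l\<in>{1..n}. \<bar>x l\<bar>)" by (rule sum_abs)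
  also have "\<dots> \<le> real n * N"
    using sum_bounded_above[of "{1..n}" "\<lambda>l. \<bar>x l\<bar>" N] le by simp
  finally have "\<bar>(\<Sum>l\<in>{1..n}. x l) / real n\<bar> \<le> N"
    using assms by (simp add: field_simps)
  then show ?thesis using le[OF assms(1)] dot_eps_vector[OF assms(1)] by (smt (verit))
qed

lemma dot_self_nonneg: "0 \<le> dot n x x"
  by (auto simp: dot_def intro!: sum_nonneg)

lemma norm3_ge:
  assumes "a \<in> {1..n}" "b \<in> {1..n}" "c \<in> {1..n}"
  shows "\<bar>dot n (eps_vector n a) x + dot n (eps_vector n b) y + dot n (eps_vector n c) z\<bar>
    \<le> 6 * norm3 n x y z"
proof -
  note nn = dot_self_nonneg[of n x] dot_self_nonneg[of n y] dot_self_nonneg[of n z]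
  have sq: "norm3 n x y z ^ 2 = dot n x x + dot n y y + dot n z z" and "0 \<le> norm3 n x y z"
    using nn by (simp_all add: norm3_def)
  then have "\<bar>dot n (eps_vector n a) x\<bar> \<le> 2 * norm3 n x y z"
    "\<bar>dot n (eps_vector n b) y\<bar> \<le> 2 * norm3 n x y z"
    "\<bar>dot n (eps_vector n c) z\<bar> \<le> 2 * norm3 n x y z"
    using assms nn by (auto intro!: abs_dot_eps_vector_le)
  then show ?thesis by linarith
qed

section \<open>Capacity and near-minimizers\<close>

lemma abs_le_one_if_exp_le:
  fixes t :: real
  assumes "exp t - 1 - t \<le> 1 / 4"
  shows "\<bar>t\<bar> \<le> 1"
proof (rule ccontr)
  assume "\<not> \<bar>t\<bar> \<le> 1"
  then consider "t > 1" | "t < - 1" by linarith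
  then show False
  proof cases
    case 1
    have "1 + t + t ^ 2 / 2 \<le> exp t"
      using exp_lower_Taylor_quadratic[of t] 1 by simp
    moreover have "t ^ 2 > 1" using 1 by (simp add: one_less_power)
    ultimately show False using assms by linarith
  next
    case 2
    \<comment> \<open>The tangent of exp at -1, together with e \<le> 3, gives exp t - 1 - t \<ge> -
      1/3 - 2t/3, which exceeds 1/3 for t < -1.\<close>
    have "1 + (t + 1) \<le> exp (t + 1)" by (rule exp_ge_add_one_self)
    then have "2 + t \<le> exp t * exp 1" by (simp add: exp_add)
    also have "\<dots> \<le> exp t * 3" using exp_le by (intro mult_left_mono) auto
    finally show False using assms 2 by argo
  qed
qed

lemma cap_le_f_fun:
  assumes "valid n rs"
  shows "cap n (array_of rs) \<le> f_fun n (array_of rs) x y z"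
proof -
  have "0 \<le> f_fun n (array_of rs) x' y' z'" for x' y' z'
    using nonneg_array_of[OF assms]
    unfolding f_fun_def nonneg_array_def by (intro sum_nonneg mult_nonneg_nonneg) auto
  then have "bdd_below (range (\<lambda>(x, y, z). f_fun n (array_of rs) x y z))"
    by (intro bdd_belowI[of _ 0]) auto
  then have "cap n (array_of rs) \<le> (\<lambda>(x, y, z). f_fun n (array_of rs) x y z) (x, y, z)"
    unfolding cap_def by (intro cINF_lower) auto
  then show ?thesis by simp
qed

text \<open>Moving along \<open>(u1, u2, u3)\<close> keeps all terms of \<open>rs\<close> equal to their weight and sends the
  extra term to \<open>0\<close>.\<close>

lemma cap_le_sum_weights:
  fixes u1 u2 u3 :: "nat \<Rightarrow> real"
  assumes v: "valid n ((1, a, b, c) # rs)"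
    and u: "(\<Sum>i\<in>{1..n}. u1 i) = 0" "(\<Sum>i\<in>{1..n}. u2 i) = 0" "(\<Sum>i\<in>{1..n}. u3 i) = 0"
    and zero: "\<And>w i j k. (w, i, j, k) \<in> set rs \<Longrightarrow> u1 i + u2 j + u3 k = 0"
    and neg: "u1 a + u2 b + u3 c < 0"
  shows "cap n (array_of ((1, a, b, c) # rs)) \<le> real_of_int (sum_list (map fst rs))"
proof (rule field_le_epsilon)
  fix e :: real assume e: "0 < e"
  define d where "d = u1 a + u2 b + u3 c"
  \<comment> \<open>Scaled so that the extra exponent becomes \<open>ln e\<close>, i.e. the extra
    term is exactly \<open>e\<close>.\<close>
  define l where "l = ln e / d"
  define x y z where "x = (\<lambda>i. l * u1 i)" and "y = (\<lambda>i. l * u2 i)" and "z = (\<lambda>i. l * u3 i)"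
  have dots: "dot n (eps_vector n i) x = l * u1 i" "dot n (eps_vector n i) y = l * u2 i"
    "dot n (eps_vector n i) z = l * u3 i" if "i \<in> {1..n}" for i
    \<comment> \<open>The directions have sum 0, so centring leaves them unchanged.\<close>
    using that u by (simp_all add: dot_eps_vector x_def y_def z_def flip: sum_distrib_left)
  have rest: "(\<Sum>(w, i, j, k)\<leftarrow>rs. real_of_int w *
      exp (dot n (eps_vector n i) x + dot n (eps_vector n j) y + dot n (eps_vector n k) z))
      = (\<Sum>(w, i, j, k)\<leftarrow>rs. real_of_int w)"
  proof (intro arg_cong[of _ _ sum_list] map_cong refl, clarify)
    fix w i j k assume r: "(w, i, j, k) \<in> set rs"
    then have "i \<in> {1..n}" "j \<in> {1..n}" "k \<in> {1..n}" using v by (auto simp: valid_def)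
    moreover have "l * u1 i + l * u2 j + l * u3 k = 0"
      using zero[OF r] by (simp flip: distrib_left)
    ultimately show "real_of_int w *
      exp (dot n (eps_vector n i) x + dot n (eps_vector n j) y + dot n (eps_vector n k) z)
      = real_of_int w"
      by (simp add: dots)
  qed
  have "l * u1 a + l * u2 b + l * u3 c = l * d"
    by (simp add: d_def algebra_simps)
  then have "l * u1 a + l * u2 b + l * u3 c = ln e"
    using neg by (simp add: l_def d_def)
  then have "f_fun n (array_of ((1, a, b, c) # rs)) x y z = e + (\<Sum>(w, i, j, k)\<leftarrow>rs. real_of_int w)"
    using v rest e by (simp add: f_fun_array_of dots)
  moreover have "(\<Sum>(w, i, j, k)\<leftarrow>rs. real_of_int w) = real_of_int (sum_list (map fst rs))"
    by (induction rs) auto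
  ultimately show "cap n (array_of ((1, a, b, c) # rs)) \<le> real_of_int (sum_list (map fst rs)) + e"
    using cap_le_f_fun[OF v, of x y z] by simp
qed

text \<open>Balance removes the linear part of the exponents, so the excess of f over the sum of the
  weights of \<open>rs\<close> is the extra term plus the sum of w * (exp t - 1 - t). All these
  summands are nonnegative, so each is at most \<epsilon>.\<close>

lemma near_minimizer:
  assumes v: "valid n ((1, a, b, c) # rs)" and bal: "balanced n D rs" and n: "n \<ge> 1"
    and cap: "cap n (array_of ((1, a, b, c) # rs)) \<le> real_of_int (sum_list (map fst rs))"
    and f: "f_fun n (array_of ((1, a, b, c) # rs)) x y z
      \<le> cap n (array_of ((1, a, b, c) # rs)) + \<epsilon>"
  defines "t \<equiv> \<lambda>i j k. dot n (eps_vector n i) x + dot n (eps_vector n j) y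
    + dot n (eps_vector n k) z"
  shows "exp (t a b c) \<le> \<epsilon>"
    and "(w, i, j, k) \<in> set rs \<Longrightarrow> 1 \<le> w \<Longrightarrow> exp (t i j k) - 1 - t i j k \<le> \<epsilon>"
proof -
  define g where "g = (\<lambda>(w, i, j, k). real_of_int w * (exp (t i j k) - 1 - t i j k))"
  have "(\<Sum>(w, i, j, k)\<leftarrow>rs. real_of_int w * t i j k) = real_of_int D * (0 + 0 + 0)"
    using bal[unfolded balanced_def, rule_format, of "\<lambda>i. dot n (eps_vector n i) x"
      "\<lambda>i. dot n (eps_vector n i) y" "\<lambda>i. dot n (eps_vector n i) z"]
    unfolding t_def sum_dot_eps_vector[OF n] .
  moreover have "sum_list (map g rs) = (\<Sum>(w, i, j, k)\<leftarrow>rs. real_of_int w * exp (t i j k))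
      - real_of_int (sum_list (map fst rs)) - (\<Sum>(w, i, j, k)\<leftarrow>rs. real_of_int w * t i j k)"
    unfolding g_def by (induction rs) (auto simp: algebra_simps)
  moreover have "f_fun n (array_of ((1, a, b, c) # rs)) x y z
      = exp (t a b c) + (\<Sum>(w, i, j, k)\<leftarrow>rs. real_of_int w * exp (t i j k))"
    using v by (simp add: f_fun_array_of t_def)
  ultimately have main: "exp (t a b c) + sum_list (map g rs) \<le> \<epsilon>"
    using f cap by simp
  have g0: "0 \<le> g r" if "r \<in> set rs" for r
  proof -
    obtain w i j k where r: "r = (w, i, j, k)" by (cases r)
    have "0 \<le> w" using v that by (auto simp: r valid_def)
    moreover have "0 \<le> exp (t i j k) - 1 - t i j k"
      using exp_ge_add_one_self[of "t i j k"] by linarith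
    ultimately show ?thesis by (simp add: g_def r)
  qed
  then have "0 \<le> sum_list (map g rs)" by (auto intro!: sum_list_nonneg)
  then show "exp (t a b c) \<le> \<epsilon>" using main by simp
  assume r: "(w, i, j, k) \<in> set rs" and w: "1 \<le> w"
  have "g (w, i, j, k) \<le> sum_list (map g rs)"
    using r g0 by (intro member_le_sum_list) auto
  moreover have "exp (t i j k) - 1 - t i j k \<le> g (w, i, j, k)"
  proof -
    have "0 \<le> exp (t i j k) - 1 - t i j k"
      using exp_ge_add_one_self[of "t i j k"] by linarith
    then show ?thesis
      using w mult_right_mono[of 1 "real_of_int w" "exp (t i j k) - 1 - t i j k"]
      by (simp add: g_def)
  qed
  ultimately show "exp (t i j k) - 1 - t i j k \<le> \<epsilon>"
    using main exp_gt_zero[of "t a b c"] by linarith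
qed


section \<open>The two-chain construction and its marginals\<close>

text \<open>The solution of \<open>b (k - 1) + 2 * b k = 6 * 2 ^ m\<close> with \<open>b (- 1) = 0\<close>: the condition that
  every chain index has marginal \<open>6 * 2 ^ m\<close>. It is an integer for \<open>k \<le> m\<close>.\<close>

definition chain_weight :: "nat \<Rightarrow> nat \<Rightarrow> int" where
  "chain_weight m k = 2 ^ (m + 1) + (- 1) ^ k * 2 ^ (m - k)"

text \<open>The three rotations give equal marginals in all slots: step k contributes its weight
  twice at \<open>s + k\<close> and once at \<open>s + k + 1\<close>.\<close>

definition chain :: "nat \<Rightarrow> nat \<Rightarrow> nat \<Rightarrow> (int \<times> nat \<times> nat \<times> nat) list" where
  "chain m s M = concat (map (\<lambda>k.
     [(chain_weight m k, s + k + 1, s + k, s + k),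
      (chain_weight m k, s + k, s + k + 1, s + k),
      (chain_weight m k, s + k, s + k, s + k + 1)]) [0..<M])"

text \<open>Under the six permutations each of the three indices occurs twice in every slot and
  receives \<open>2 * chain_weight m m\<close> there, which is what the last index of a chain
  lacks.\<close>

definition link :: "nat \<Rightarrow> nat \<Rightarrow> nat \<Rightarrow> nat \<Rightarrow> (int \<times> nat \<times> nat \<times> nat) list" where
  "link m v w z = map (Pair (chain_weight m m))
     [(v, w, z), (v, z, w), (w, v, z), (w, z, v), (z, v, w), (z, w, v)]"

text \<open>Indices \<open>1..m + 1\<close> and \<open>m + 2..2 * m + 2\<close> form the two chains, \<open>2 * m + 3\<close> is the index of
  value \<open>0\<close>, and any further indices are padding.\<close>

definition construction :: "nat \<Rightarrow> nat \<Rightarrow> (int \<times> nat \<times> nat \<times> nat) list" where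
  "construction m n = chain m 1 m @ chain m (m + 2) m @ link m (m + 1) (2 * m + 2) (2 * m + 3) @
     [(6 * 2 ^ m - 2 * chain_weight m m, 2 * m + 3, 2 * m + 3, 2 * m + 3)] @
     map (\<lambda>i. (6 * 2 ^ m, i, i, i)) [2 * m + 4..<n + 1]"

lemma chain_weight_0: "chain_weight m 0 = 3 * 2 ^ m"
  by (simp add: chain_weight_def)

text \<open>From \<open>k = m\<close> on, truncated subtraction stops the halving of
  \<open>2 ^ (m - k)\<close>.\<close>

lemma chain_weight_Suc:
  assumes "k < m"
  shows "2 * chain_weight m (Suc k) = 6 * 2 ^ m - chain_weight m k"
proof -
  have "m - k = Suc (m - Suc k)" using assms by simp
  then show ?thesis by (simp add: chain_weight_def)
qed

text \<open>The lower bound lets \<open>near_minimizer\<close> control every chain triple; the upper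
  bound makes the weight of the triple at \<open>2 * m + 3\<close> nonnegative.\<close>

lemma chain_weight_bounds:
  shows "1 \<le> chain_weight m k" "chain_weight m k \<le> 3 * 2 ^ m"
proof -
  have "(2::int) ^ (m - k) \<le> 2 ^ m" "(1::int) \<le> 2 ^ m" "(0::int) \<le> 2 ^ (m - k)"
    by (simp_all add: power_increasing)
  moreover have "chain_weight m k = 2 * 2 ^ m + 2 ^ (m - k) \<or>
      chain_weight m k = 2 * 2 ^ m - 2 ^ (m - k)"
    by (simp add: chain_weight_def minus_one_power_iff)
  ultimately show "1 \<le> chain_weight m k" "chain_weight m k \<le> 3 * 2 ^ m"
    by linarith+
qed

lemma chain_Suc:
  "chain m s (Suc M) = chain m s M @
     [(chain_weight m M, s + M + 1, s + M, s + M),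
      (chain_weight m M, s + M, s + M + 1, s + M),
      (chain_weight m M, s + M, s + M, s + M + 1)]"
  by (simp add: chain_def)

text \<open>A chain stopped after M steps has full marginals except at its last index, where
  \<open>2 * chain_weight m M\<close> is missing. The recurrence moves this deficit one index
  further.\<close>

lemma sum_chain:
  fixes X Y Z :: "nat \<Rightarrow> real"
  assumes "M \<le> m"
  defines "S \<equiv> \<lambda>i. X i + Y i + Z i"
  shows "(\<Sum>(w, a, b, c)\<leftarrow>chain m s M. real_of_int w * (X a + Y b + Z c)) =
    6 * 2 ^ m * (\<Sum>k\<le>M. S (s + k)) - 2 * real_of_int (chain_weight m M) * S (s + M)"
  using assms(1)
proof (induction M)
  case 0
  show ?case by (simp add: chain_def chain_weight_0)
next
  case (Suc M)
  have "real_of_int (2 * chain_weight m (Suc M)) = real_of_int (6 * 2 ^ m - chain_weight m M)"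
    using chain_weight_Suc[of M m] Suc.prems by simp
  then have w: "real_of_int (chain_weight m M) = 6 * 2 ^ m - 2 * real_of_int (chain_weight m (Suc M))"
    by simp
  show ?case
    using Suc by (simp add: chain_Suc w S_def algebra_simps)
qed

lemma sum_split_blocks:
  fixes g :: "nat \<Rightarrow> real"
  assumes "2 * m + 3 \<le> n"
  shows "(\<Sum>i\<in>{1..n}. g i) = (\<Sum>k\<le>m. g (1 + k)) + (\<Sum>k\<le>m. g (m + 2 + k)) + g (2 * m + 3)
    + (\<Sum>i\<in>{2 * m + 4..<n + 1}. g i)"
proof -
  have shift: "(\<Sum>k\<le>m. g (a + k)) = (\<Sum>i\<in>{a..<a + m + 1}. g i)" for a
    by (rule sum.reindex_bij_witness[of _ "\<lambda>i. i - a" "\<lambda>k. a + k"]) auto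
  have "(\<Sum>i\<in>{1..n}. g i) = (\<Sum>i\<in>{1..<n + 1}. g i)"
    by (intro sum.cong) auto
  also have "\<dots> = (\<Sum>i\<in>{1..<m + 2}. g i) + (\<Sum>i\<in>{m + 2..<n + 1}. g i)"
    using assms by (subst sum.atLeastLessThan_concat) auto
  also have "(\<Sum>i\<in>{m + 2..<n + 1}. g i) =
      (\<Sum>i\<in>{m + 2..<2 * m + 3}. g i) + (\<Sum>i\<in>{2 * m + 3..<n + 1}. g i)"
    using assms by (subst sum.atLeastLessThan_concat) auto
  also have "(\<Sum>i\<in>{2 * m + 3..<n + 1}. g i) = g (2 * m + 3) + (\<Sum>i\<in>{2 * m + 4..<n + 1}. g i)"
    using assms sum.atLeast_Suc_lessThan[of "2 * m + 3" "n + 1" g]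
    by (simp add: add.commute del: sum.op_ivl_Suc)
  finally have "(\<Sum>i\<in>{1..n}. g i) = (\<Sum>i\<in>{1..<m + 2}. g i) + ((\<Sum>i\<in>{m + 2..<2 * m + 3}. g i)
      + (g (2 * m + 3) + (\<Sum>i\<in>{2 * m + 4..<n + 1}. g i)))" .
  moreover have idx: "1 + m + 1 = m + 2" "m + 2 + m + 1 = 2 * m + 3" by auto
  ultimately show ?thesis
    using shift[of 1, unfolded idx] shift[of "m + 2", unfolded idx] by linarith
qed

text \<open>The link fills the deficits at both chain ends, the diagonal triple at
  \<open>2 * m + 3\<close> supplies what the link leaves open there, and each padding index is
  saturated by its own diagonal triple.\<close>

lemma balanced_construction:
  assumes "2 * m + 3 \<le> n"
  shows "balanced n (6 * 2 ^ m) (construction m n)"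
  unfolding balanced_def
proof (intro allI)
  fix X Y Z :: "nat \<Rightarrow> real"
  define S where "S i = X i + Y i + Z i" for i
  have "(\<Sum>i\<in>{1..n}. X i) + (\<Sum>i\<in>{1..n}. Y i) + (\<Sum>i\<in>{1..n}. Z i) = (\<Sum>i\<in>{1..n}. S i)"
    by (simp add: S_def sum.distrib)
  also have "\<dots> = (\<Sum>k\<le>m. S (1 + k)) + (\<Sum>k\<le>m. S (m + 2 + k)) + S (2 * m + 3)
    + (\<Sum>i\<in>{2 * m + 4..<n + 1}. S i)"
    by (rule sum_split_blocks[OF assms])
  finally have split: "(\<Sum>i\<in>{1..n}. X i) + (\<Sum>i\<in>{1..n}. Y i) + (\<Sum>i\<in>{1..n}. Z i) = \<dots>" .
  have link: "(\<Sum>(w, a, b, c)\<leftarrow>link m p q r. real_of_int w * (X a + Y b + Z c)) =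
      2 * real_of_int (chain_weight m m) * (S p + S q + S r)" for p q r
    by (simp add: link_def S_def algebra_simps)
  have pads: "(\<Sum>(w, a, b, c)\<leftarrow>map (\<lambda>i. (6 * 2 ^ m, i, i, i)) [2 * m + 4..<n + 1].
      real_of_int w * (X a + Y b + Z c)) = 6 * 2 ^ m * (\<Sum>i\<in>{2 * m + 4..<n + 1}. S i)"
    unfolding sum_distrib_left S_def map_map interv_sum_list_conv_sum_set_nat
    by (simp add: o_def interv_sum_list_conv_sum_set_nat del: upt_Suc sum.op_ivl_Suc)
  have idx: "1 + m = m + 1" "m + 2 + m = 2 * m + 2" by auto
  show "(\<Sum>(w, a, b, c)\<leftarrow>construction m n. real_of_int w * (X a + Y b + Z c)) =
     real_of_int (6 * 2 ^ m) * ((\<Sum>i\<in>{1..n}. X i) + (\<Sum>i\<in>{1..n}. Y i) + (\<Sum>i\<in>{1..n}. Z i))"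
    unfolding split construction_def map_append sum_list_append link pads
      sum_chain[OF order_refl] S_def[symmetric] idx
    by (simp add: S_def algebra_simps)
qed

lemma set_chain:
  "set (chain m s M) = (\<Union>k<M. {(chain_weight m k, s + k + 1, s + k, s + k),
      (chain_weight m k, s + k, s + k + 1, s + k), (chain_weight m k, s + k, s + k, s + k + 1)})"
  by (auto simp: chain_def)

lemma valid_construction:
  assumes "2 * m + 3 \<le> n"
  shows "valid n (construction m n)"
  using assms chain_weight_bounds(1)[of m, THEN order_trans[OF zero_le_one]]
    chain_weight_bounds(2)[of m m]
  unfolding valid_def construction_def by (auto simp: set_chain link_def)

lemma length_construction:
  assumes "2 * m + 3 \<le> n"
  shows "length (construction m n) \<le> 4 * n"
proof -
  have "length (chain m s M) = 3 * M" for s M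
    by (induction M) (simp_all add: chain_def)
  then have "length (construction m n) = 6 * m + 7 + (n + 1 - (2 * m + 4))"
    by (simp add: construction_def link_def del: upt_Suc)
  then show ?thesis using assms by linarith
qed

section \<open>Escape direction and growth along a chain\<close>

definition direction :: "nat \<Rightarrow> nat \<Rightarrow> real" where
  "direction m i = (if i \<le> m + 1 then - ((- 2) ^ (i - 1))
     else if i \<le> 2 * m + 2 then (- 2) ^ (i - (m + 2)) else 0)"

lemma sum_direction:
  assumes "2 * m + 3 \<le> n"
  shows "(\<Sum>i\<in>{1..n}. direction m i) = 0"
proof -
  have "(\<Sum>k\<le>m. direction m (1 + k)) + (\<Sum>k\<le>m. direction m (m + 2 + k)) = 0"
    by (simp add: direction_def flip: sum.distrib)
  then show ?thesis
    unfolding sum_split_blocks[OF assms] by (simp add: direction_def)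
qed

text \<open>Powers of -2 solve 2 * s k + s (k + 1) = 0 exactly. The link is satisfied since the
  chains end in opposite values and the third index has value 0.\<close>

lemma direction_construction:
  assumes "(w, i, j, k) \<in> set (construction m n)"
  shows "direction m i + direction m j + direction m k = 0"
proof -
  have lower: "direction m (1 + l) = - ((- 2) ^ l)" if "l \<le> m" for l
    using that by (simp add: direction_def)
  have upper: "direction m (m + 2 + l) = (- 2) ^ l" if "l \<le> m" for l
    using that by (simp add: direction_def)
  have zero: "direction m l = 0" if "2 * m + 3 \<le> l" for l
    using that by (simp add: direction_def)
  consider "(w, i, j, k) \<in> set (chain m 1 m)" | "(w, i, j, k) \<in> set (chain m (m + 2) m)"
    | "(w, i, j, k) \<in> set (link m (m + 1) (2 * m + 2) (2 * m + 3))"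
    | "2 * m + 3 \<le> i" "i = j" "j = k"
    using assms by (auto simp: construction_def)
  then show ?thesis
  proof cases
    case 1
    then obtain l where "l < m" and "(i, j, k) \<in> {(1 + Suc l, 1 + l, 1 + l),
        (1 + l, 1 + Suc l, 1 + l), (1 + l, 1 + l, 1 + Suc l)}"
      by (auto simp: set_chain)
    then show ?thesis using lower[of l] lower[of "Suc l"] by auto
  next
    case 2
    then obtain l where "l < m" and "(i, j, k) \<in> {(m + 2 + Suc l, m + 2 + l, m + 2 + l),
        (m + 2 + l, m + 2 + Suc l, m + 2 + l), (m + 2 + l, m + 2 + l, m + 2 + Suc l)}"
      by (auto simp: set_chain)
    then show ?thesis using upper[of l] upper[of "Suc l"] by auto
  next
    case 3
    have "direction m (m + 1) = - ((- 2) ^ m)" "direction m (2 * m + 2) = (- 2) ^ m"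
      "direction m (2 * m + 3) = 0"
      by (simp_all add: direction_def)
    with 3 show ?thesis unfolding link_def by fastforce
  next
    case 4
    then show ?thesis using zero by simp
  qed
qed

lemma chain_growth:
  fixes X Y Z :: "nat \<Rightarrow> real"
  assumes small: "\<And>w i j k. (w, i, j, k) \<in> set (construction m n) \<Longrightarrow> 1 \<le> w \<Longrightarrow>
      \<bar>X i + Y j + Z k\<bar> \<le> 1"
  shows "2 ^ m * (\<bar>X 1 + Y 1 + Z 1\<bar> - 3) \<le> \<bar>X (m + 1) + Y (m + 1) + Z (m + 1)\<bar>"
proof -
  define S where "S k = X (k + 1) + Y (k + 1) + Z (k + 1)" for k
  \<comment> \<open>The recursion loses at most 3 per doubling; 3 is the fixed point of u \<mapsto>
    2 * u - 3, so the distance above 3 doubles.\<close>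
  have "2 ^ l * (\<bar>S 0\<bar> - 3) \<le> \<bar>S l\<bar> - 3" if "l \<le> m" for l
    using that
  proof (induction l)
    case 0
    show ?case by simp
  next
    case (Suc l)
    have mem: "(chain_weight m l, r) \<in> set (construction m n)"
      if "r \<in> {(l + 2, l + 1, l + 1), (l + 1, l + 2, l + 1), (l + 1, l + 1, l + 2)}" for r
      using Suc.prems that unfolding construction_def by (force simp: set_chain)
    note b = chain_weight_bounds(1)[of m l]
    have "\<bar>X (l + 2) + Y (l + 1) + Z (l + 1)\<bar> \<le> 1" "\<bar>X (l + 1) + Y (l + 2) + Z (l + 1)\<bar> \<le> 1"
      "\<bar>X (l + 1) + Y (l + 1) + Z (l + 2)\<bar> \<le> 1"
      by (rule small[OF mem b]; simp)+
    \<comment> \<open>The sum of the three rotated exponents.\<close>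
    then have "\<bar>2 * S l + S (Suc l)\<bar> \<le> 3"
      by (simp add: S_def)
    then have "2 * \<bar>S l\<bar> - 3 \<le> \<bar>S (Suc l)\<bar>"
      by linarith
    moreover have "2 ^ l * (\<bar>S 0\<bar> - 3) \<le> \<bar>S l\<bar> - 3"
      using Suc by simp
    ultimately show ?case by simp
  qed
  from this[of m] show ?thesis by (simp add: S_def)
qed

section \<open>Assembly with explicit constants\<close>

definition hard_array :: "nat \<Rightarrow> (nat \<Rightarrow> nat \<Rightarrow> nat \<Rightarrow> real) \<Rightarrow> bool" where
  "hard_array n p \<longleftrightarrow> nonneg_array n p \<and>
     real (card (array_support n p)) \<le> 5 * real n \<and>
     (\<forall>(i, j, k)\<in>array_support n p.
        \<exists>q. p i j k = of_rat q \<and> real_of_int (rat_bit_complexity q) \<le> 10 * real n) \<and>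
     (\<forall>\<epsilon> x y z. 0 < \<epsilon> \<and> \<epsilon> \<le> exp (- 10 * real n ^ 2 * ln (real n)) \<and>
        f_fun n p x y z \<le> cap n p + \<epsilon> \<longrightarrow>
        (n \<ge> 2 \<longrightarrow> norm3 n x y z \<ge> 1 / 48 * (2 powr (real n / 3) * ln (1 / \<epsilon>))))"

text \<open>Separates the analysis from the combinatorics: the directions determine the capacity,
  and the amplification by \<open>2 powr (n / 3)\<close> enters through \<open>grow\<close>.\<close>

lemma hard_array_of:
  fixes u1 u2 u3 :: "nat \<Rightarrow> real"
  assumes "n \<ge> 2"
    and v: "valid n ((1, a, b, c) # rs)" and bal: "balanced n D rs"
    and len: "length rs \<le> 4 * n" and D: "D \<le> 6 * 2 ^ n"
    and u: "(\<Sum>i\<in>{1..n}. u1 i) = 0" "(\<Sum>i\<in>{1..n}. u2 i) = 0" "(\<Sum>i\<in>{1..n}. u3 i) = 0"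
    and zero: "\<And>w i j k. (w, i, j, k) \<in> set rs \<Longrightarrow> u1 i + u2 j + u3 k = 0"
    and neg: "u1 a + u2 b + u3 c < 0"
    and grow: "\<And>X Y Z :: nat \<Rightarrow> real.
      (\<And>w i j k. (w, i, j, k) \<in> set rs \<Longrightarrow> 1 \<le> w \<Longrightarrow> \<bar>X i + Y j + Z k\<bar> \<le> 1) \<Longrightarrow>
      6 \<le> \<bar>X a + Y b + Z c\<bar> \<Longrightarrow>
      \<exists>l1\<in>{1..n}. \<exists>l2\<in>{1..n}. \<exists>l3\<in>{1..n}.
        2 powr (real n / 3) * \<bar>X a + Y b + Z c\<bar> \<le> 8 * \<bar>X l1 + Y l2 + Z l3\<bar>"
  shows "hard_array n (array_of ((1, a, b, c) # rs))"
proof -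
  define p where "p = array_of ((1, a, b, c) # rs)"
  have n: "1 \<le> n" using assms(1) by simp
  have "real (card (array_support n p)) \<le> 5 * real n"
    using card_array_support_array_of[of n "(1, a, b, c) # rs"] len assms(1) unfolding p_def by simp
  moreover have "\<exists>q. p i j k = of_rat q \<and> real_of_int (rat_bit_complexity q) \<le> 10 * real n"
    for i j k
  proof -
    obtain q where q: "p i j k = real_of_int q" "0 \<le> q" "q \<le> 1 + D * int n"
      using array_of_int[OF v, of i j k] sum_weights_balanced[OF bal] by (auto simp: p_def)
    have "int n < 2 ^ n" by (metis of_nat_less_two_power)
    then have "D * int n \<le> (6 * 2 ^ n) * 2 ^ n" using D by (intro mult_mono) auto
    moreover have "(1::int) \<le> 2 ^ n * 2 ^ n" by (simp flip: power_add)
    \<comment> \<open>The total weight is at most 1 + 6 * 4^n, hence below 2^(2n + 3).\<close>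
    ultimately have "q < 8 * (2 ^ n * 2 ^ n)" using q(3) by linarith
    then have "q < 2 ^ (n + n + 3)" unfolding power_add by simp
    then have "rat_bit_complexity (of_int q) \<le> int (n + n + 3) + 1"
      by (rule rat_bit_complexity_of_int_le[OF q(2)])
    also have "\<dots> \<le> int (10 * n)" using assms(1) by simp
    finally have "real_of_int (rat_bit_complexity (of_int q)) \<le> real_of_int (int (10 * n))"
      by (simp only: of_int_le_iff)
    then show ?thesis using q(1) by (intro exI[of _ "of_int q"]) simp
  qed
  moreover have "norm3 n x y z \<ge> 1 / 48 * (2 powr (real n / 3) * ln (1 / \<epsilon>))"
    if e: "0 < \<epsilon>" "\<epsilon> \<le> exp (- 10 * real n ^ 2 * ln (real n))" and f: "f_fun n p x y z \<le> cap n p + \<epsilon>"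
    for \<epsilon> x y z
  proof -
    define t where "t i j k = dot n (eps_vector n i) x + dot n (eps_vector n j) y
      + dot n (eps_vector n k) z" for i j k
    have cap: "cap n (array_of ((1, a, b, c) # rs)) \<le> real_of_int (sum_list (map fst rs))"
      using v u zero neg by (rule cap_le_sum_weights)
    note near = near_minimizer[OF v bal n cap f[unfolded p_def]]
    have "ln (1 / 2 :: real) \<le> 1 / 2 - 1" by (rule ln_le_minus_one) simp
    then have "1 / 2 \<le> ln (2 :: real)" by (simp add: ln_div)
    also have "\<dots> \<le> ln (real n)" using assms(1) by simp
    finally have "4 * (1 / 2) \<le> real n ^ 2 * ln (real n)"
      using assms(1) power_mono[of 2 "real n" 2] by (intro mult_mono) auto
    then have "- 10 * real n ^ 2 * ln (real n) \<le> - 6" by linarith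
    \<comment> \<open>This threshold lies below 1/4, which bounds the exponents of \<open>rs\<close>
      by 1, and makes the extra exponent at least 6, twice the loss 3 in
      \<open>chain_growth\<close>.\<close>
    then have e6: "\<epsilon> \<le> exp (- 6)"
      using e(2) by (meson exp_le_cancel_iff order_trans)
    have "exp (- 6 :: real) \<le> 1 / 4"
      using exp_ge_add_one_self[of "6 :: real"] by (simp add: exp_minus field_simps)
    then have small: "\<bar>t i j k\<bar> \<le> 1" if "(w, i, j, k) \<in> set rs" "1 \<le> w" for w i j k
      using near(2)[OF that] e6 unfolding t_def
      by (intro abs_le_one_if_exp_le) linarith
    have "ln (exp (t a b c)) \<le> ln \<epsilon>"
      using near(1) e(1) unfolding t_def by (subst ln_le_cancel_iff) auto
    then have L: "ln (1 / \<epsilon>) \<le> \<bar>t a b c\<bar>" using e(1) by (simp add: ln_div)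
    have "ln \<epsilon> \<le> ln (exp (- 6))" using e(1) e6 by (subst ln_le_cancel_iff) auto
    then have "6 \<le> \<bar>t a b c\<bar>" using L e(1) by (simp add: ln_div)
    with small have "\<exists>l1\<in>{1..n}. \<exists>l2\<in>{1..n}. \<exists>l3\<in>{1..n}.
        2 powr (real n / 3) * \<bar>t a b c\<bar> \<le> 8 * \<bar>t l1 l2 l3\<bar>"
      unfolding t_def by (rule grow)
    then obtain l1 l2 l3 where l: "l1 \<in> {1..n}" "l2 \<in> {1..n}" "l3 \<in> {1..n}"
      and "2 powr (real n / 3) * \<bar>t a b c\<bar> \<le> 8 * \<bar>t l1 l2 l3\<bar>"
      by blast
    moreover have "2 powr (real n / 3) * ln (1 / \<epsilon>) \<le> 2 powr (real n / 3) * \<bar>t a b c\<bar>"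
      using L by (intro mult_left_mono) auto
    moreover have "\<bar>t l1 l2 l3\<bar> \<le> 6 * norm3 n x y z"
      unfolding t_def by (rule norm3_ge[OF l])
    \<comment> \<open>The factors 8 from \<open>grow\<close> and 6 from \<open>norm3_ge\<close> give
      48.\<close>
    ultimately show ?thesis by linarith
  qed
  ultimately show ?thesis
    using nonneg_array_of[OF v] unfolding hard_array_def p_def[symmetric] by blast
qed

text \<open>Two chains and a zero index need n \<ge> 3. For n = 2 the factor
  \<open>2 powr (2 / 3)\<close> is below 8, so the extra exponent itself is large enough.\<close>

lemma hard_array_2: "hard_array 2 (array_of [(1, 1, 2, 2), (1, 1, 1, 1), (1, 2, 2, 2)])"
proof -
  have iv: "{1..2} = {1, 2 :: nat}" by auto
  define u :: "nat \<Rightarrow> real" where "u i = (if i = 1 then 1 else - 1)" for i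
  have u: "u 1 = 1" "u 2 = - 1" by (simp_all add: u_def)
  have "2 powr (real 2 / 3) \<le> (2 :: real) powr 1"
    by (intro powr_mono) auto
  then have p: "2 powr (real 2 / 3) * d \<le> 8 * d" if "0 \<le> d" for d :: real
    using that by (intro mult_right_mono) auto
  show ?thesis
  proof (rule hard_array_of[where D = 1 and ?u1.0 = "\<lambda>i. - 2 * u i" and ?u2.0 = u and ?u3.0 = u])
    show "balanced 2 1 [(1, 1, 1, 1), (1, 2, 2, 2)]"
      unfolding balanced_def iv by simp
  next
    fix X Y Z :: "nat \<Rightarrow> real"
    have "2 powr (real 2 / 3) * \<bar>X 1 + Y 2 + Z 2\<bar> \<le> 8 * \<bar>X 1 + Y 2 + Z 2\<bar>"
      by (rule p) simp
    then show "\<exists>l1\<in>{1..2}. \<exists>l2\<in>{1..2}. \<exists>l3\<in>{1..2}.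
        2 powr (real 2 / 3) * \<bar>X 1 + Y 2 + Z 2\<bar> \<le> 8 * \<bar>X l1 + Y l2 + Z l3\<bar>"
      unfolding iv by blast
  next
    fix w i j k assume "(w, i, j, k) \<in> set [(1 :: int, 1 :: nat, 1 :: nat, 1 :: nat), (1, 2, 2, 2)]"
    then show "- 2 * u i + u j + u k = 0" by auto
  qed (unfold iv, simp_all add: u[simplified])
qed

lemma hard_array_construction:
  assumes "n \<ge> 3"
  defines "m \<equiv> (n - 3) div 2"
  shows "hard_array n (array_of ((1, 1, 1, 1) # construction m n))"
proof -
  have m: "2 * m + 3 \<le> n" "n \<le> 2 * m + 4" using assms(1) by (auto simp: m_def)
  \<comment> \<open>n \<le> 2m + 4 gives n / 3 \<le> m + 2.\<close>
  have "2 powr (real n / 3) \<le> 2 powr (real m + 2)"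
    using m by (intro powr_mono) auto
  also have "\<dots> = 4 * (2 :: real) ^ m" by (simp add: powr_add powr_realpow)
  finally have p: "2 powr (real n / 3) \<le> 4 * (2 :: real) ^ m" .
  show ?thesis
  proof (rule hard_array_of[where D = "6 * 2 ^ m" and ?u1.0 = "direction m" and ?u2.0 = "direction m"
        and ?u3.0 = "direction m"])
    show "2 \<le> n" using assms(1) by simp
    show "valid n ((1, 1, 1, 1) # construction m n)"
      using valid_construction[OF m(1)] assms by simp
    show "balanced n (6 * 2 ^ m) (construction m n)" by (rule balanced_construction[OF m(1)])
    show "length (construction m n) \<le> 4 * n" by (rule length_construction[OF m(1)])
    show "(6 :: int) * 2 ^ m \<le> 6 * 2 ^ n" using m by (simp add: power_increasing)
    show "(\<Sum>i\<in>{1..n}. direction m i) = 0" by (rule sum_direction[OF m(1)])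
    then show "(\<Sum>i\<in>{1..n}. direction m i) = 0" "(\<Sum>i\<in>{1..n}. direction m i) = 0" by assumption+
    show "direction m 1 + direction m 1 + direction m 1 < 0" by (simp add: direction_def)
  next
    fix w i j k assume "(w, i, j, k) \<in> set (construction m n)"
    then show "direction m i + direction m j + direction m k = 0" by (rule direction_construction)
  next
    fix X Y Z :: "nat \<Rightarrow> real"
    assume small: "\<And>w i j k. (w, i, j, k) \<in> set (construction m n) \<Longrightarrow> 1 \<le> w \<Longrightarrow>
        \<bar>X i + Y j + Z k\<bar> \<le> 1"
      and large: "6 \<le> \<bar>X 1 + Y 1 + Z 1\<bar>"
    \<comment> \<open>For u \<ge> 6 one has u \<le> 2 * (u - 3), which absorbs the additive
      loss.\<close>
    have "2 powr (real n / 3) * \<bar>X 1 + Y 1 + Z 1\<bar> \<le> (4 * 2 ^ m) * (2 * (\<bar>X 1 + Y 1 + Z 1\<bar> - 3))"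
      using p large by (intro mult_mono) auto
    also have "\<dots> \<le> 8 * \<bar>X (m + 1) + Y (m + 1) + Z (m + 1)\<bar>"
      using chain_growth[of m n X Y Z] small by argo
    finally show "\<exists>l1\<in>{1..n}. \<exists>l2\<in>{1..n}. \<exists>l3\<in>{1..n}.
        2 powr (real n / 3) * \<bar>X 1 + Y 1 + Z 1\<bar> \<le> 8 * \<bar>X l1 + Y l2 + Z l3\<bar>"
      using m(1) by (intro bexI[of _ "m + 1"]) auto
  qed
qed

theorem theorem1p1:
  "\<exists>C>0. \<exists>K>0. \<exists>B>0. \<exists>c>0. \<forall>n\<ge>1. \<exists>p :: nat \<Rightarrow> nat \<Rightarrow> nat \<Rightarrow> real.
     nonneg_array n p \<and>
     real (card (array_support n p)) \<le> K * real n \<and>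
     (\<forall>(i, j, k)\<in>array_support n p.
        \<exists>q. p i j k = of_rat q \<and> real_of_int (rat_bit_complexity q) \<le> B * real n) \<and>
     (\<forall>\<epsilon> x y z. 0 < \<epsilon> \<and> \<epsilon> \<le> exp (- C * real n ^ 2 * ln (real n)) \<and>
        f_fun n p x y z \<le> cap n p + \<epsilon> \<longrightarrow>
        (n \<ge> 2 \<longrightarrow> norm3 n x y z \<ge> c * (2 powr (real n / 3) * ln (1 / \<epsilon>))))"
proof -
  have hard: "\<exists>p. hard_array n p" if n: "n \<ge> 1" for n
  proof -
    consider "n = 1" | "n = 2" | "n \<ge> 3" using n by linarith
    then show ?thesis
    proof cases
      case 1
      \<comment> \<open>For n = 1 the norm bound is not claimed: the centred vector is 0, f is
        constant, and the origin is a minimizer. The zero array meets the size conditions.\<close>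
      then have "hard_array n (\<lambda>_ _ _. 0)"
        by (simp add: hard_array_def nonneg_array_def array_support_def case_prod_unfold)
      then show ?thesis by blast
    next
      case 2
      then show ?thesis using hard_array_2 by blast
    next
      case 3
      then show ?thesis using hard_array_construction by blast
    qed
  qed
  show ?thesis
    by (rule exI[of _ 10], rule conjI, simp, rule exI[of _ 5], rule conjI, simp,
        rule exI[of _ 10], rule conjI, simp, rule exI[of _ "1 / 48"], rule conjI, simp,
        intro allI impI, rule hard[unfolded hard_array_def])
qed

end
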